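(* Assume $R_0>\frac{1}{\mu q}$. Allowing reneging does not change the socially optimal threshold nor the optimal social welfare: there is a nonnegative integer $n^\star$ which is a socially optimal threshold both in the non-reneging case and in the reneging case, and the optimal social welfare is the same in both cases, i.e. $$S^N(n^\star)=\max_{x\ge0}S^N(x)=\max_{x\ge0}S^R(x)=S^R(n^\star).$$
   Context: Parameters $\lambda,\mu>0$, $0<q<1$, $R_0>0$. Single-server first-come-first-served queue: Poisson arrivals of rate $\lambda$, i.i.d. exponential($\mu$) services. After each service a customer departs successfully with probability $q$ (reward $R_0$); otherwise the service fails and she immediately goes to the end of the queue. An arriving customer who sees $j-1$ customers in the system may join, taking position $j$ (position 1 is in service), or balk (payoff 0). Waiting costs 1 per unit time. Threshold strategy: for $x\ge 0$, with $n=\lfloor x\rfloor$ and $p=x-n$: $u^{(x)}(i)=1$ if $i\le n$, $u^{(x)}(n+1)=p$, $u^{(x)}(i)=0$ if $i\ge n+2$. Non-reneging case: a customer with threshold $x$ joins at position $i$ with probability $u^{(x)}(i)$ and then stays until success. For $1\le i\le j\le\lceil x\rceil+1$, $w^{(x)}_{i,j}$ is the expected remaining time in the system of a tagged customer in position $i$ with $j$ customers in the system, all others using threshold $x$; it is the unique solution of $$(\lambda+\mu)w_{i,j}=1+\lambda\left[u^{(x)}(j+1)w_{i,j+1}+(1-u^{(x)}(j+1))w_{i,j}\right]+\mu\, s_{i,j},$$ with $s_{1,j}=(1-q)w_{j,j}$ and $s_{i,j}=q\,w_{i-1,j-1}+(1-q)\,w_{i-1,j}$ for $i>1$ (terms with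 zero coefficient are omitted). Put $z^{(x)}_{i,j}=R_0-w^{(x)}_{i,j}$. Reneging case: in addition, a customer with threshold $x$ whose service fails, and who would be in position $i$ at the end of the queue, stays with probability $u^{(x)}(i)$ and otherwise leaves without reward. When everybody uses threshold $x$, $\hat z^{(x)}_{i,j}$ ($1\le i\le j\le\lfloor x\rfloor+1$) is the expected future payoff (reward minus waiting cost) of a customer in position $i$ when $j$ customers are in the system; it is the unique solution of $$(\lambda+\mu)\hat z_{i,j}=-1+\lambda\left[u^{(x)}(j+1)\hat z_{i,j+1}+(1-u^{(x)}(j+1))\hat z_{i,j}\right]+\mu\,\hat s_{i,j},$$ with $\hat s_{1,j}=qR_0+(1-q)u^{(x)}(j)\hat z_{j,j}$ and $\hat s_{i,j}=\left[q+(1-q)(1-u^{(x)}(j))\right]\hat z_{i-1,j-1}+(1-q)u^{(x)}(j)\hat z_{i-1,j}$ for $i>1$. Stationary distributions of the number of customers when everyone uses threshold $x$: $\pi^{(x)}$ (non-reneging) is that of the birth-death chain with birth rate $\lambda u^{(x)}(j+1)$ in state $j\ge0$ and death rate $\mu q$ in states $j\ge1$; $\hat\pi^{(x)}$ (reneging) is that of the birth-death chain with the same birth rates and death rate $\mu q+\mu(1-q)(1-u^{(x)}(j))$ in states $j\ge1$ (both supported on $\{0,\ldots,\lceil x\rceil\}$). Social welfare (expected net benefit of all customers per unit time): $$S^N(x)=\lambda\left(\sum_{k=1}^{\lfloor x\rfloor}\pi^{(x)}_{k-1}z^{(x)}_{k,k}+(x-\lfloor x\rfloor)\pi^{(x)}_{\lfloor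 x\rfloor}z^{(x)}_{\lfloor x\rfloor+1,\lfloor x\rfloor+1}\right),$$ $$S^R(x)=\lambda\left(\sum_{k=1}^{\lfloor x\rfloor}\hat\pi^{(x)}_{k-1}\hat z^{(x)}_{k,k}+(x-\lfloor x\rfloor)\hat\pi^{(x)}_{\lfloor x\rfloor}\hat z^{(x)}_{\lfloor x\rfloor+1,\lfloor x\rfloor+1}\right).$$ A socially optimal threshold is a maximizer over $x\ge0$. *)

theory Defs
  imports Complex_Main
begin

definition threshold :: "real \<Rightarrow> nat \<Rightarrow> real" where
  "threshold x i =
     (let n = nat \<lfloor>x\<rfloor> in
      if i \<le> n then 1 else if i = n + 1 then x - real n else 0)"

text \<open>
  Each family of expected times or payoffs is the unique solution of its linear first-step system
  on a finite triangle of pairs (position \<open>i\<close>, number in system \<open>j\<close>). A solution is required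
  to vanish off the triangle, so that it is unique as a total function. Terms referring to
  \<open>j + 1\<close> beyond the triangle occur only with coefficient \<open>0\<close>.
\<close>

definition positions :: "nat \<Rightarrow> (nat \<times> nat) set" where
  "positions m = {(i, j). 1 \<le> i \<and> i \<le> j \<and> j \<le> m}"

definition remaining_time_system ::
    "real \<Rightarrow> real \<Rightarrow> real \<Rightarrow> real \<Rightarrow> (nat \<Rightarrow> nat \<Rightarrow> real) \<Rightarrow> bool" where
  "remaining_time_system lam \<mu> q x w \<longleftrightarrow>
     (let u = threshold x;
          s = (\<lambda>i j. if i = 1 then (1 - q) * w j j
                     else q * w (i - 1) (j - 1) + (1 - q) * w (i - 1) j)
      in (\<forall>(i, j) \<in> positions (nat \<lceil>x\<rceil> + 1).
            (lam + \<mu>) * w i j =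
              1 + lam * (u (j + 1) * w i (j + 1) + (1 - u (j + 1)) * w i j) + \<mu> * s i j) \<and>
         (\<forall>i j. (i, j) \<notin> positions (nat \<lceil>x\<rceil> + 1) \<longrightarrow> w i j = 0))"

definition remaining_time :: "real \<Rightarrow> real \<Rightarrow> real \<Rightarrow> real \<Rightarrow> nat \<Rightarrow> nat \<Rightarrow> real" where
  "remaining_time lam \<mu> q x = (THE w. remaining_time_system lam \<mu> q x w)"

definition payoff_N ::
    "real \<Rightarrow> real \<Rightarrow> real \<Rightarrow> real \<Rightarrow> real \<Rightarrow> nat \<Rightarrow> nat \<Rightarrow> real" where
  "payoff_N lam \<mu> q R\<^sub>0 x i j = R\<^sub>0 - remaining_time lam \<mu> q x i j"

definition reneging_payoff_system ::
    "real \<Rightarrow> real \<Rightarrow> real \<Rightarrow> real \<Rightarrow> real \<Rightarrow> (nat \<Rightarrow> nat \<Rightarrow> real) \<Rightarrow> bool" where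
  "reneging_payoff_system lam \<mu> q R\<^sub>0 x z \<longleftrightarrow>
     (let u = threshold x;
          s = (\<lambda>i j. if i = 1 then q * R\<^sub>0 + (1 - q) * u j * z j j
                     else (q + (1 - q) * (1 - u j)) * z (i - 1) (j - 1)
                          + (1 - q) * u j * z (i - 1) j)
      in (\<forall>(i, j) \<in> positions (nat \<lfloor>x\<rfloor> + 1).
            (lam + \<mu>) * z i j =
              - 1 + lam * (u (j + 1) * z i (j + 1) + (1 - u (j + 1)) * z i j) + \<mu> * s i j) \<and>
         (\<forall>i j. (i, j) \<notin> positions (nat \<lfloor>x\<rfloor> + 1) \<longrightarrow> z i j = 0))"

definition payoff_R ::
    "real \<Rightarrow> real \<Rightarrow> real \<Rightarrow> real \<Rightarrow> real \<Rightarrow> nat \<Rightarrow> nat \<Rightarrow> real" where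
  "payoff_R lam \<mu> q R\<^sub>0 x = (THE z. reneging_payoff_system lam \<mu> q R\<^sub>0 x z)"

text \<open>
  Stationarity of a probability distribution on the natural numbers for the birth-death chain with
  birth rates \<open>b j\<close> (\<open>j \<ge> 0\<close>) and death rates \<open>d j\<close> (\<open>j \<ge> 1\<close>; \<open>d 0\<close> is ignored), expressed by the
  global balance equations.
\<close>

definition bd_stationary :: "(nat \<Rightarrow> real) \<Rightarrow> (nat \<Rightarrow> real) \<Rightarrow> (nat \<Rightarrow> real) \<Rightarrow> bool" where
  "bd_stationary b d p \<longleftrightarrow>
     (\<forall>j. 0 \<le> p j) \<and> p sums 1 \<and>
     p 0 * b 0 = p 1 * d 1 \<and>
     (\<forall>j\<ge>1. p j * (b j + d j) = p (j - 1) * b (j - 1) + p (j + 1) * d (j + 1))"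

definition stationary_N :: "real \<Rightarrow> real \<Rightarrow> real \<Rightarrow> real \<Rightarrow> nat \<Rightarrow> real" where
  "stationary_N lam \<mu> q x =
     (THE p. bd_stationary (\<lambda>j. lam * threshold x (j + 1)) (\<lambda>j. \<mu> * q) p)"

definition stationary_R :: "real \<Rightarrow> real \<Rightarrow> real \<Rightarrow> real \<Rightarrow> nat \<Rightarrow> real" where
  "stationary_R lam \<mu> q x =
     (THE p. bd_stationary (\<lambda>j. lam * threshold x (j + 1))
               (\<lambda>j. \<mu> * q + \<mu> * (1 - q) * (1 - threshold x j)) p)"

definition welfare ::
    "real \<Rightarrow> real \<Rightarrow> (nat \<Rightarrow> real) \<Rightarrow> (nat \<Rightarrow> nat \<Rightarrow> real) \<Rightarrow> real" where
  "welfare lam x p z =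
     (let n = nat \<lfloor>x\<rfloor> in
      lam * ((\<Sum>k = 1..n. p (k - 1) * z k k) + (x - real n) * p n * z (n + 1) (n + 1)))"

definition S_N :: "real \<Rightarrow> real \<Rightarrow> real \<Rightarrow> real \<Rightarrow> real \<Rightarrow> real" where
  "S_N lam \<mu> q R\<^sub>0 x = welfare lam x (stationary_N lam \<mu> q x) (payoff_N lam \<mu> q R\<^sub>0 x)"

definition S_R :: "real \<Rightarrow> real \<Rightarrow> real \<Rightarrow> real \<Rightarrow> real \<Rightarrow> real" where
  "S_R lam \<mu> q R\<^sub>0 x = welfare lam x (stationary_R lam \<mu> q x) (payoff_R lam \<mu> q R\<^sub>0 x)"

definition socially_optimal :: "(real \<Rightarrow> real) \<Rightarrow> real \<Rightarrow> bool" where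
  "socially_optimal S x \<longleftrightarrow> is_arg_max S (\<lambda>y. 0 \<le> y) x"

end

theory Submission
  imports Defs
begin

text \<open>
  The argument is a form of Little's law. Let \<open>V j\<close> be the sum of the future payoffs of all \<open>j\<close>
  customers present. Summing the first-step equations over the positions makes the order of service
  drop out: \<open>V\<close> solves a Poisson equation of the birth-death chain of the number in system
  (\<open>total_payoff_drift\<close>), in which an arrival who joins brings in her own payoff, each customer
  present costs \<open>1\<close> per unit time, and a busy server earns \<open>\<mu> * q * R\<^sub>0\<close> per unit time. Averaging over
  the stationary distribution removes \<open>V\<close> (\<open>total_payoff_balance\<close>), so in both models the welfare is
  the stationary mean of the net earning rate \<open>g j\<close>, with \<open>g 0 = 0\<close> and
  \<open>g j = \<mu> * q * R\<^sub>0 - j\<close> for \<open>j \<ge> 1\<close>.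

  Put \<open>\<rho> = lam / (\<mu> * q)\<close> and \<open>x = n + p\<close> with \<open>n = \<lfloor>x\<rfloor>\<close>. Positions up to \<open>n\<close> are always
  accepted, by arrivals and by failed customers alike, so in both models the stationary weights of
  the states \<open>0, \<dots>, n\<close> are \<open>\<rho> ^ j\<close>; the models differ only in the weight \<open>t * \<rho> ^ (n + 1)\<close>
  of state \<open>n + 1\<close>. Without reneging \<open>t = p\<close>; with reneging
  \<open>t = q * p / (1 - (1 - q) * p)\<close>. In both cases \<open>t\<close> lies in the unit interval and vanishes for
  integer \<open>x\<close>. The two welfare functions therefore agree at the integers, and between \<open>n\<close> and
  \<open>n + 1\<close> each is a weighted mean of the two values at the ends (\<open>geometric_average_le\<close>). So both are
  maximized at an integer \<open>n\<close> maximizing the common sequence, which exists because \<open>g j \<le> 0\<close> for large \<open>j\<close>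
  while the value at \<open>0\<close> is \<open>0\<close> (\<open>geometric_average_attains_max\<close>).

  The payoffs and the stationary distributions are given by definite descriptions, so the identities
  above apply only once existence and uniqueness are known. For the linear systems this is
  \<open>first_step_unique_solution\<close>, a contraction argument; for the chains it is \<open>the_bd_stationary\<close>, by
  detailed balance.
\<close>

section \<open>Unique solvability of the first-step systems\<close>

text \<open>
  Banach's fixed point theorem for the norm given by the supremum of \<open>\<bar>f s\<bar> / h s\<close>. Finiteness of the
  common support \<open>A\<close> makes every difference of values of \<open>T\<close> finite in this norm and turns pointwise
  convergence of the iterates into convergence in norm.
\<close>

lemma weighted_contraction_unique_fixpoint:
  fixes T :: "('a \<Rightarrow> real) \<Rightarrow> 'a \<Rightarrow> real" and h :: "'a \<Rightarrow> real"
  assumes fin: "finite A" and supp: "\<And>f s. s \<notin> A \<Longrightarrow> T f s = 0"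
    and h: "\<And>s. h s > 0" and \<theta>: "0 \<le> \<theta>" "\<theta> < 1"
    and contr: "\<And>f g C s. (\<And>t. \<bar>f t - g t\<bar> \<le> C * h t) \<Longrightarrow> \<bar>T f s - T g s\<bar> \<le> \<theta> * C * h s"
  shows "\<exists>!f. T f = f"
proof -
  have h0: "h s \<ge> 0" for s using h[of s] by simp
  have bound: "\<exists>C\<ge>0. \<forall>s. \<bar>f s - g s\<bar> \<le> C * h s"
    if "\<And>s. s \<notin> A \<Longrightarrow> f s = g s" for f g
  proof (intro exI conjI allI)
    let ?C = "\<Sum>t\<in>A. \<bar>f t - g t\<bar> / h t"
    show C0: "?C \<ge> 0" by (intro sum_nonneg) (simp add: h0)
    fix s
    show "\<bar>f s - g s\<bar> \<le> ?C * h s"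
    proof (cases "s \<in> A")
      case True
      have "\<bar>f s - g s\<bar> / h s \<le> ?C"
        using True fin by (intro member_le_sum) (auto simp: h0)
      then show ?thesis using h[of s] by (simp add: pos_divide_le_eq)
    next
      case False
      then show ?thesis using that[of s] C0 h0[of s] by simp
    qed
  qed
  have unique: "f = g" if "T f = f" "T g = g" for f g
  proof
    fix s
    have "f t = g t" if "t \<notin> A" for t
      using supp[OF that, of f] supp[OF that, of g] \<open>T f = f\<close> \<open>T g = g\<close> by simp
    from bound[of f g, OF this] obtain C where C: "\<And>t. \<bar>f t - g t\<bar> \<le> C * h t" by blast
    have "\<bar>f t - g t\<bar> \<le> \<theta> ^ k * C * h t" for k t
    proof (induction k arbitrary: t)
      case 0
      then show ?case using C by simp
    next
      case (Suc k)
      then show ?case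
        using contr[of f g "\<theta> ^ k * C" t] that by (simp add: mult.assoc)
    qed
    moreover have "(\<lambda>k. \<theta> ^ k * C * h s) \<longlonglongrightarrow> 0 * C * h s"
      by (intro tendsto_intros LIMSEQ_power_zero) (use \<theta> in simp)
    ultimately have "\<bar>f s - g s\<bar> \<le> 0"
      by (intro LIMSEQ_le_const) auto
    then show "f s = g s" by simp
  qed
  have "\<exists>f. T f = f"
  proof -
    define X where "X k = (T ^^ k) (\<lambda>_. 0)" for k
    have X_Suc: "X (Suc k) = T (X k)" for k by (simp add: X_def)
    obtain C where C: "\<And>t. \<bar>X 1 t - X 0 t\<bar> \<le> C * h t"
      using bound[of "X 1" "X 0"] supp by (auto simp: X_def)
    have step: "\<bar>X (Suc k) t - X k t\<bar> \<le> \<theta> ^ k * C * h t" for k t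
    proof (induction k arbitrary: t)
      case 0
      then show ?case using C by simp
    next
      case (Suc k)
      then show ?case
        using contr[of "X (Suc k)" "X k" "\<theta> ^ k * C" t] by (simp add: X_Suc mult.assoc)
    qed
    have "convergent (\<lambda>k. X k s)" for s
    proof -
      have "summable (\<lambda>k. \<theta> ^ k * C * h s)"
        using \<theta> by (intro summable_mult2 summable_geometric) simp
      then have "summable (\<lambda>k. X (Suc k) s - X k s)"
        by (rule summable_comparison_test') (use step in simp)
      then have "convergent (\<lambda>n. \<Sum>k<n. X (Suc k) s - X k s)"
        by (simp add: summable_iff_convergent)
      then show ?thesis
        unfolding sum_lessThan_telescope[of "\<lambda>k. X k s"] by (simp add: X_def)
    qed
    define f where "f s = lim (\<lambda>k. X k s)" for s
    have f: "(\<lambda>k. X k s) \<longlonglongrightarrow> f s" for s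
      using \<open>convergent (\<lambda>k. X k s)\<close> by (simp add: convergent_LIMSEQ_iff f_def)
    have X_supp: "X k s = 0" if "s \<notin> A" for s k
      using supp[OF that] by (cases k) (simp_all add: X_def)
    have f_supp: "f s = 0" if "s \<notin> A" for s
      by (rule LIMSEQ_unique[OF f]) (simp add: X_supp[OF that])
    have "\<bar>T f s - f s\<bar> \<le> 0" for s
    proof (rule field_le_epsilon)
      fix e :: real assume "e > 0"
      define d where "d = e / ((\<theta> + 1) * h s)"
      have d: "d > 0" using \<open>e > 0\<close> h \<theta> by (simp add: d_def)
      have "\<forall>\<^sub>F k in sequentially. \<forall>t\<in>A. \<bar>f t - X k t\<bar> \<le> d * h t"
      proof (intro eventually_ball_finite[OF fin] ballI)
        fix t
        have "d * h t > 0" using d h by simp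
        then have "\<forall>\<^sub>F k in sequentially. dist (X k t) (f t) < d * h t"
          using f[of t] by (rule tendstoD[rotated])
        then show "\<forall>\<^sub>F k in sequentially. \<bar>f t - X k t\<bar> \<le> d * h t"
          by eventually_elim (simp add: dist_real_def abs_minus_commute)
      qed
      then obtain N where N: "\<And>k t. k \<ge> N \<Longrightarrow> t \<in> A \<Longrightarrow> \<bar>f t - X k t\<bar> \<le> d * h t"
        by (auto simp: eventually_sequentially)
      have N': "\<bar>f t - X k t\<bar> \<le> d * h t" if "k \<ge> N" for k t
        using N[OF that, of t] f_supp[of t] X_supp[of t k] d h0[of t] by (cases "t \<in> A") auto
      have "\<bar>T f s - X (Suc N) s\<bar> \<le> \<theta> * d * h s"
        unfolding X_Suc by (rule contr) (rule N', simp)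
      moreover have "\<bar>f s - X (Suc N) s\<bar> \<le> d * h s" by (rule N') simp
      ultimately have "\<bar>T f s - f s\<bar> \<le> \<theta> * d * h s + d * h s" by linarith
      also have "\<dots> = d * ((\<theta> + 1) * h s)" by (simp add: algebra_simps)
      also have "\<dots> = e" using h[of s] \<theta> by (simp add: d_def)
      finally show "\<bar>T f s - f s\<bar> \<le> 0 + e" by simp
    qed
    then have "T f = f" by (intro ext) simp
    then show ?thesis by blast
  qed
  then show ?thesis using unique by blast
qed

text \<open>
  A common form of both systems: the flow \<open>c\<close> per unit time, the lump sum \<open>r\<close> expected when the tagged
  customer finishes a service, and the probability \<open>b j\<close> that a customer served while \<open>j\<close> are present
  goes back to the queue. Remaining times have \<open>c = 1\<close> and \<open>r = 0\<close>; payoffs have \<open>c = - 1\<close> and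
  \<open>r = q * R\<^sub>0\<close>.
\<close>

definition first_step ::
    "real \<Rightarrow> real \<Rightarrow> real \<Rightarrow> real \<Rightarrow> (nat \<Rightarrow> real) \<Rightarrow> (nat \<Rightarrow> real) \<Rightarrow>
      (nat \<Rightarrow> nat \<Rightarrow> real) \<Rightarrow> nat \<Rightarrow> nat \<Rightarrow> real" where
  "first_step lam \<mu> c r u b z i j =
     c + lam * (u (j + 1) * z i (j + 1) + (1 - u (j + 1)) * z i j) +
     \<mu> * (if i = 1 then r + b j * z j j
          else (1 - b j) * z (i - 1) (j - 1) + b j * z (i - 1) j)"

lemma convex_combination_abs_le:
  fixes a x y B :: real
  assumes "0 \<le> a" "a \<le> 1" "\<bar>x\<bar> \<le> B" "\<bar>y\<bar> \<le> B"
  shows "\<bar>a * x + (1 - a) * y\<bar> \<le> B"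
proof -
  have "\<bar>a * x + (1 - a) * y\<bar> \<le> a * \<bar>x\<bar> + (1 - a) * \<bar>y\<bar>"
    using assms abs_triangle_ineq[of "a * x" "(1 - a) * y"] by (simp add: abs_mult)
  also have "\<dots> \<le> B" using assms by (intro convex_bound_le) auto
  finally show ?thesis .
qed

text \<open>
  Customers are lost only from position 1, so the plain supremum norm does not contract. The
  weight \<open>m + q * i\<close> does better: an arrival leaves it unchanged, a service moves position \<open>i > 1\<close> to
  \<open>i - 1\<close> and lowers it by exactly \<open>q\<close>, and from position 1 it may rise to at most
  \<open>m * (1 + q)\<close>, but only with probability at most \<open>1 - q\<close>, and
  \<open>(1 - q) * (1 + q) * m \<le> m\<close>. So a service lowers the expected weight by at least \<open>q\<close> from every
  position; the contraction factor results from comparing this gain with the largest weight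
  \<open>m + q * m\<close>.
\<close>

lemma first_step_contraction:
  fixes lam \<mu> q C :: real
  assumes par: "lam > 0" "\<mu> > 0" "0 < q" "q < 1"
    and u: "\<And>j. 0 \<le> u j" "\<And>j. u j \<le> 1" and b: "\<And>j. 0 \<le> b j" "\<And>j. b j \<le> 1 - q"
    and diff: "\<And>i j. \<bar>f i j - g i j\<bar> \<le> C * (m + q * i)"
    and ij: "(i, j) \<in> positions m"
  shows "\<bar>first_step lam \<mu> c r u b f i j - first_step lam \<mu> c r u b g i j\<bar>
          \<le> (lam + \<mu>) * ((1 - \<mu> * q / ((lam + \<mu>) * (m + q * m))) * C * (m + q * i))"
proof -
  define D where "D i j = f i j - g i j" for i j
  have D: "\<bar>D i j\<bar> \<le> C * (m + q * i)" for i j using diff by (simp add: D_def)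
  have pos: "1 \<le> i" "i \<le> j" "j \<le> m" "1 \<le> m" using ij by (auto simp: positions_def)
  have mq: "real m + q * real i > 0" for i using pos par by (simp add: add_pos_nonneg)
  have "0 \<le> C * (m + q * i)" using D[of i i] by linarith
  then have C: "C \<ge> 0" using mq[of i] by (simp add: zero_le_mult_iff)
  define A where "A = u (j + 1) * D i (j + 1) + (1 - u (j + 1)) * D i j"
  define S where "S = (if i = 1 then b j * D j j
                       else (1 - b j) * D (i - 1) (j - 1) + b j * D (i - 1) j)"
  have eq: "first_step lam \<mu> c r u b f i j - first_step lam \<mu> c r u b g i j = lam * A + \<mu> * S"
    by (simp add: first_step_def A_def S_def D_def algebra_simps)
  have A: "\<bar>A\<bar> \<le> C * (m + q * i)"
    unfolding A_def using u D by (intro convex_combination_abs_le)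
  have S: "\<bar>S\<bar> \<le> C * (m + q * i - q)"
  proof (cases "i = 1")
    case True
    have "\<bar>S\<bar> = b j * \<bar>D j j\<bar>" using True b by (simp add: S_def abs_mult)
    also have "\<dots> \<le> (1 - q) * (C * (m + q * j))"
      using b D[of j j] par by (intro mult_mono) auto
    also have "\<dots> \<le> (1 - q) * (C * (m + q * m))"
      using par pos C by (intro mult_left_mono add_left_mono) auto
    also have "\<dots> = C * m - C * m * q * q" by (simp add: algebra_simps)
    also have "\<dots> \<le> C * (m + q * i - q)" using True C par by simp
    finally show ?thesis .
  next
    case False
    then have i: "real (i - 1) = real i - 1" using pos by simp
    have "\<bar>D (i - 1) k\<bar> \<le> C * (m + q * i - q)" for k
      using D[of "i - 1" k] unfolding i by (simp add: algebra_simps)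
    then have "\<bar>b j * D (i - 1) j + (1 - b j) * D (i - 1) (j - 1)\<bar> \<le> C * (m + q * i - q)"
      using b[of j] par by (intro convex_combination_abs_le) auto
    then show ?thesis using False by (simp add: S_def add.commute)
  qed
  have "\<bar>lam * A + \<mu> * S\<bar> \<le> lam * \<bar>A\<bar> + \<mu> * \<bar>S\<bar>"
    using abs_triangle_ineq[of "lam * A" "\<mu> * S"] par by (simp add: abs_mult)
  also have "\<dots> \<le> lam * (C * (m + q * i)) + \<mu> * (C * (m + q * i - q))"
    using A S par by (intro add_mono mult_left_mono) auto
  also have "\<dots> = (lam + \<mu>) * C * (m + q * i) - \<mu> * q * C" by (simp add: algebra_simps)
  also have "\<dots> \<le> (lam + \<mu>) * C * (m + q * i) - \<mu> * q * C * ((m + q * i) / (m + q * m))"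
  proof -
    have "(m + q * i) / (m + q * m) \<le> 1"
      using pos par mq[of m] by simp
    then have "\<mu> * q * C * ((m + q * i) / (m + q * m)) \<le> \<mu> * q * C * 1"
      using par C by (intro mult_left_mono) auto
    then show ?thesis by simp
  qed
  also have "\<dots> = (lam + \<mu>) * ((1 - \<mu> * q / ((lam + \<mu>) * (m + q * m))) * C * (m + q * i))"
  proof -
    have "lam + \<mu> \<noteq> 0" "real m + q * m \<noteq> 0" using par mq[of m] by auto
    then show ?thesis by (simp add: divide_simps) (simp add: algebra_simps)
  qed
  finally show ?thesis unfolding eq .
qed

lemma first_step_unique_solution:
  fixes lam \<mu> q :: real
  assumes par: "lam > 0" "\<mu> > 0" "0 < q" "q < 1"
    and u: "\<And>j. 0 \<le> u j" "\<And>j. u j \<le> 1" and b: "\<And>j. 0 \<le> b j" "\<And>j. b j \<le> 1 - q"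
    and m: "m \<ge> 1"
  shows "\<exists>!z. (\<forall>(i, j) \<in> positions m. (lam + \<mu>) * z i j = first_step lam \<mu> c r u b z i j) \<and>
              (\<forall>i j. (i, j) \<notin> positions m \<longrightarrow> z i j = 0)"
    (is "\<exists>!z. ?sol z")
proof -
  define T where "T f = (\<lambda>(i, j). if (i, j) \<in> positions m
      then first_step lam \<mu> c r u b (curry f) i j / (lam + \<mu>) else 0)" for f
  define h where "h = (\<lambda>(i :: nat, j :: nat). real m + q * real i)"
  define \<theta> where "\<theta> = 1 - \<mu> * q / ((lam + \<mu>) * (m + q * m))"
  have sol_iff: "?sol z \<longleftrightarrow> T (case_prod z) = case_prod z" for z
    using par by (auto simp: T_def fun_eq_iff field_simps split: if_splits)
  have "\<exists>!f. T f = f"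
  proof (rule weighted_contraction_unique_fixpoint[where A = "positions m" and h = h and \<theta> = \<theta>])
    show "finite (positions m)"
      by (rule finite_subset[of _ "{..m} \<times> {..m}"]) (auto simp: positions_def)
    show "T f s = 0" if "s \<notin> positions m" for f and s :: "nat \<times> nat"
      using that by (auto simp: T_def split: prod.splits)
    show "h s > 0" for s :: "nat \<times> nat" using m par by (auto simp: h_def add_pos_nonneg split: prod.splits)
    show "\<theta> < 1" using par m by (simp add: \<theta>_def add_pos_pos)
    have "\<mu> * q \<le> (lam + \<mu>) * (m + q * m)"
    proof (rule mult_mono)
      have "q * 1 \<le> q * m" using m par by (intro mult_left_mono) auto
      then show "q \<le> m + q * m" by simp
    qed (use par in auto)
    then show \<theta>0: "\<theta> \<ge> 0" using par m by (simp add: \<theta>_def add_pos_pos)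
    fix f g :: "nat \<times> nat \<Rightarrow> real" and C and s :: "nat \<times> nat"
    assume diff: "\<And>t. \<bar>f t - g t\<bar> \<le> C * h t"
    obtain i j where s: "s = (i, j)" by (cases s)
    show "\<bar>T f s - T g s\<bar> \<le> \<theta> * C * h s"
    proof (cases "(i, j) \<in> positions m")
      case True
      have "\<bar>first_step lam \<mu> c r u b (curry f) i j - first_step lam \<mu> c r u b (curry g) i j\<bar>
          \<le> (lam + \<mu>) * (\<theta> * C * h (i, j))"
        unfolding \<theta>_def h_def prod.case
        by (rule first_step_contraction[OF par u b _ True])
          (use diff in \<open>auto simp: h_def split: prod.splits\<close>)
      then show ?thesis
        using True par by (simp add: s T_def diff_divide_distrib[symmetric] pos_divide_le_eq
            mult.commute)
    next
      case False
      have "0 \<le> C * h s" using diff[of s] by linarith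
      then show ?thesis using False \<theta>0 by (simp add: s T_def mult.assoc)
    qed
  qed
  then obtain f where f: "T f = f" and uniq: "\<And>g. T g = g \<Longrightarrow> g = f" by blast
  show ?thesis
  proof (rule ex1I)
    show "?sol (curry f)" unfolding sol_iff using f by simp
  next
    fix z assume "?sol z"
    then have "case_prod z = f" unfolding sol_iff by (rule uniq)
    then show "z = curry f" by (auto simp: fun_eq_iff)
  qed
qed

section \<open>Stationary distributions\<close>

definition bd_weight :: "(nat \<Rightarrow> real) \<Rightarrow> (nat \<Rightarrow> real) \<Rightarrow> nat \<Rightarrow> real" where
  "bd_weight b d j = (\<Prod>k<j. b k / d (k + 1))"

lemma bd_weight_0 [simp]: "bd_weight b d 0 = 1"
  by (simp add: bd_weight_def)

lemma bd_weight_balance: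
  assumes "d (j + 1) \<noteq> 0"
  shows "bd_weight b d j * b j = bd_weight b d (j + 1) * d (j + 1)"
  using assms by (simp add: bd_weight_def)

text \<open>
  The net flow across the cut between \<open>j\<close> and \<open>j + 1\<close> is the same for every \<open>j\<close> by global balance, and it
  vanishes at the boundary state \<open>0\<close>.
\<close>

lemma bd_stationary_detailed_balance:
  assumes "bd_stationary b d p"
  shows "p j * b j = p (j + 1) * d (j + 1)"
proof (induction j)
  case 0
  then show ?case using assms by (simp add: bd_stationary_def)
next
  case (Suc j)
  have "p (Suc j) * (b (Suc j) + d (Suc j)) = p j * b j + p (Suc j + 1) * d (Suc j + 1)"
    using assms by (simp add: bd_stationary_def)
  then show ?case using Suc by (simp add: algebra_simps)
qed

text \<open>
  The vanishing birth rate \<open>b m\<close> gives all states beyond \<open>m\<close> weight \<open>0\<close>, which makes the weights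
  summable. Uniqueness holds because global balance forces detailed balance, which leaves only
  \<open>p 0\<close> free.
\<close>

lemma the_bd_stationary:
  assumes b: "\<And>j. b j \<ge> 0" and d: "\<And>j. d (Suc j) > 0" and m: "b m = 0"
  shows "(THE p. bd_stationary b d p) = (\<lambda>j. bd_weight b d j / (\<Sum>k\<le>m. bd_weight b d k))"
proof -
  let ?W = "bd_weight b d" let ?Z = "\<Sum>k\<le>m. bd_weight b d k"
  have W0: "?W j \<ge> 0" for j using b less_imp_le[OF d] by (simp add: bd_weight_def prod_nonneg)
  have W_fin: "?W j = 0" if "j > m" for j
    unfolding bd_weight_def by (rule prod_zero) (use that m in auto)
  have "?W 0 \<le> ?Z" by (rule member_le_sum) (use W0 in auto)
  then have Z: "?Z > 0" by simp
  have bal: "?W j * b j = ?W (j + 1) * d (j + 1)" for j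
    by (rule bd_weight_balance) (use d[of j] in simp)
  have W_sums: "?W sums ?Z" by (rule sums_finite) (use W_fin in auto)
  show ?thesis
  proof (rule the_equality)
    show "bd_stationary b d (\<lambda>j. ?W j / ?Z)"
      unfolding bd_stationary_def
    proof (intro conjI allI impI)
      show "0 \<le> ?W j / ?Z" for j using W0 Z by simp
      show "(\<lambda>j. ?W j / ?Z) sums 1" using sums_divide[OF W_sums, of ?Z] Z by simp
      show "?W 0 / ?Z * b 0 = ?W 1 / ?Z * d 1" using bal[of 0] by simp
      fix j :: nat assume "j \<ge> 1"
      then have "?W (j - 1) * b (j - 1) = ?W j * d j" using bal[of "j - 1"] by simp
      moreover note bal[of j]
      ultimately show "?W j / ?Z * (b j + d j) =
          ?W (j - 1) / ?Z * b (j - 1) + ?W (j + 1) / ?Z * d (j + 1)"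
        by (simp add: distrib_left add_divide_distrib)
    qed
  next
    fix p assume p: "bd_stationary b d p"
    have pW: "p j = p 0 * ?W j" for j
    proof (induction j)
      case (Suc j)
      have "p (Suc j) * d (Suc j) = p j * b j"
        using bd_stationary_detailed_balance[OF p, of j] by simp
      also have "\<dots> = p 0 * ?W (Suc j) * d (Suc j)" using Suc bal[of j] by simp
      finally show ?case using d[of j] by simp
    qed simp
    have "(\<lambda>j. p 0 * ?W j) sums (p 0 * ?Z)" by (rule sums_mult[OF W_sums])
    moreover have "(\<lambda>j. p 0 * ?W j) sums 1"
      using p unfolding bd_stationary_def pW[symmetric] by blast
    ultimately have "p 0 * ?Z = 1" by (rule sums_unique2)
    then have "p 0 = 1 / ?Z" using Z by (simp add: field_simps)
    then show "p = (\<lambda>j. ?W j / ?Z)" using pW by (metis (no_types) mult_1 times_divide_eq_left)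
  qed
qed

section \<open>Welfare as a stationary average\<close>

text \<open>
  After a service at state \<open>j + 1\<close> the customers still present are, whatever their order, in positions
  \<open>1, \<dots>, j\<close> if the served one leaves, and \<open>1, \<dots>, j + 1\<close> if she returns. Hence the sum of the payoffs over all
  positions satisfies an equation in the number of customers alone. The joining customer's own
  payoff appears on the right, because after an arrival \<open>V\<close> counts it although the equations summed
  are those of the customers already present.
\<close>

lemma total_payoff_drift:
  fixes lam \<mu> c r :: real
  defines "V \<equiv> \<lambda>z j. \<Sum>i=1..j. z i j"
  assumes step: "\<And>i j. (i, j) \<in> positions m \<Longrightarrow> (lam + \<mu>) * z i j = first_step lam \<mu> c r u b z i j"
    and j: "Suc j \<le> m"
  shows "lam * u (j + 2) * (V z (j + 2) - V z (j + 1)) + \<mu> * (1 - b (j + 1)) * (V z j - V z (j + 1))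
       = lam * u (j + 2) * z (j + 2) (j + 2) - (c * real (j + 1) + \<mu> * r)"
proof -
  let ?J = "Suc j"
  define s where "s i = (if i = 1 then r + b ?J * z ?J ?J
      else (1 - b ?J) * z (i - 1) j + b ?J * z (i - 1) ?J)" for i :: nat
  have "(\<Sum>i=1..?J. s i) = s 1 + (\<Sum>i=1..j. s (Suc i))"
    by (simp add: sum.atLeast_Suc_atMost sum.shift_bounds_cl_Suc_ivl del: sum.cl_ivl_Suc)
  also have "(\<Sum>i=1..j. s (Suc i)) = (1 - b ?J) * V z j + b ?J * (\<Sum>i=1..j. z i ?J)"
    by (auto simp: V_def s_def sum.distrib sum_distrib_left intro!: sum.cong)
  also have "(\<Sum>i=1..j. z i ?J) = V z ?J - z ?J ?J"
    by (simp add: V_def)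
  finally have s_sum: "(\<Sum>i=1..?J. s i) = r + (1 - b ?J) * V z j + b ?J * V z ?J"
    by (simp add: s_def algebra_simps)
  have arr: "(\<Sum>i=1..?J. z i (Suc ?J)) = V z (Suc ?J) - z (Suc ?J) (Suc ?J)"
    by (simp add: V_def)
  have "(lam + \<mu>) * V z ?J = (\<Sum>i=1..?J. (lam + \<mu>) * z i ?J)"
    by (simp add: V_def sum_distrib_left del: sum.cl_ivl_Suc)
  also have "\<dots> = (\<Sum>i=1..?J. c + lam * (u (Suc ?J) * z i (Suc ?J)
      + (1 - u (Suc ?J)) * z i ?J) + \<mu> * s i)"
    using j by (intro sum.cong refl, subst step) (auto simp: positions_def first_step_def s_def)
  also have "\<dots> = real ?J * c + lam * (u (Suc ?J) * (\<Sum>i=1..?J. z i (Suc ?J))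
      + (1 - u (Suc ?J)) * V z ?J) + \<mu> * (\<Sum>i=1..?J. s i)"
    by (simp add: V_def sum.distrib sum_distrib_left[symmetric] del: sum.cl_ivl_Suc)
  finally show ?thesis
    unfolding s_sum arr by (simp add: algebra_simps)
qed

text \<open>
  A reversible measure annihilates the generator. Applied to \<open>V\<close>, the partial sums telescope to the
  flow across the last cut, which is \<open>0\<close> at the top state. The left side is the rate at which
  joining customers bring in payoff, the right side the rate at which payoff is realized.
\<close>

lemma total_payoff_balance:
  fixes lam \<mu> c r :: real
  assumes step: "\<And>i j. (i, j) \<in> positions m \<Longrightarrow> (lam + \<mu>) * z i j = first_step lam \<mu> c r u b z i j"
    and bal: "\<And>j. p j * (lam * u (j + 1)) = p (j + 1) * (\<mu> * (1 - b (j + 1)))"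
    and m: "u (m + 1) = 0"
  shows "(\<Sum>j\<le>m. p j * (lam * u (j + 1) * z (j + 1) (j + 1)))
       = (\<Sum>j\<le>m. p j * (if j = 0 then 0 else c * real j + \<mu> * r))"
proof -
  define V where "V j = (\<Sum>i=1..j. z i j)" for j
  define g where "g j = (if j = 0 then 0 else c * real j + \<mu> * r)" for j :: nat
  have "(\<Sum>j\<le>k. p j * (lam * u (j + 1) * z (j + 1) (j + 1) - g j))
      = p k * (lam * u (k + 1)) * (V (k + 1) - V k)" if "k \<le> m" for k
    using that
  proof (induction k)
    case 0
    then show ?case by (simp add: V_def g_def)
  next
    case (Suc k)
    have drift: "lam * u (k + 2) * z (k + 2) (k + 2) - g (k + 1) =
        lam * u (k + 2) * (V (k + 2) - V (k + 1)) + \<mu> * (1 - b (k + 1)) * (V k - V (k + 1))"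
      using total_payoff_drift[OF step \<open>Suc k \<le> m\<close>] by (simp add: V_def g_def)
    have "(\<Sum>j\<le>Suc k. p j * (lam * u (j + 1) * z (j + 1) (j + 1) - g j))
        = p k * (lam * u (k + 1)) * (V (k + 1) - V k)
          + p (k + 1) * (lam * u (k + 2) * z (k + 2) (k + 2) - g (k + 1))"
      using Suc by simp
    also have "\<dots> = p (k + 1) * (lam * u (k + 2)) * (V (k + 2) - V (k + 1))"
      unfolding drift bal by (simp add: algebra_simps)
    finally show ?case by simp
  qed
  from this[of m] m show ?thesis
    by (simp add: right_diff_distrib sum_subtractf g_def)
qed

definition net_rate :: "real \<Rightarrow> nat \<Rightarrow> real" where
  "net_rate a j = (if j = 0 then 0 else a - real j)"

text \<open>
  The mean of \<open>g\<close> under weights \<open>\<rho> ^ j\<close> on \<open>{0..n + 1}\<close>, the last one damped by \<open>t\<close>. It moves from the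
  undamped mean over \<open>{0..n}\<close> at \<open>t = 0\<close> to that over \<open>{0..n + 1}\<close> at \<open>t = 1\<close>.
\<close>

definition geometric_average :: "real \<Rightarrow> (nat \<Rightarrow> real) \<Rightarrow> nat \<Rightarrow> real \<Rightarrow> real" where
  "geometric_average \<rho> g n t =
     ((\<Sum>j\<le>n. \<rho> ^ j * g j) + t * (\<rho> ^ (n + 1) * g (n + 1))) / ((\<Sum>j\<le>n. \<rho> ^ j) + t * \<rho> ^ (n + 1))"

lemma threshold_simps:
  assumes "x \<ge> 0"
  shows "i \<le> nat \<lfloor>x\<rfloor> \<Longrightarrow> threshold x i = 1"
    and "threshold x (Suc (nat \<lfloor>x\<rfloor>)) = x - real (nat \<lfloor>x\<rfloor>)"
    and "i > Suc (nat \<lfloor>x\<rfloor>) \<Longrightarrow> threshold x i = 0"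
    and "0 \<le> x - real (nat \<lfloor>x\<rfloor>)" and "x - real (nat \<lfloor>x\<rfloor>) \<le> 1"
  using assms by (simp_all add: threshold_def Let_def) linarith+

lemma threshold_bounds:
  assumes "x \<ge> 0"
  shows "0 \<le> threshold x i" and "threshold x i \<le> 1"
  using threshold_simps(4,5)[OF assms] by (auto simp: threshold_def Let_def)

text \<open>
  Positions up to \<open>n\<close> are always accepted, by arrivals and by failed customers, so the weights of
  consecutive states up to \<open>n\<close> have ratio \<open>\<rho> = lam / (\<mu> * q)\<close>. The step from \<open>n\<close> to \<open>n + 1\<close> has
  birth rate \<open>lam * (x - n)\<close> and death rate \<open>\<mu> * (1 - b (n + 1))\<close>, which accounts for the factor in front of \<open>\<rho> ^ (n + 1)\<close>.
\<close>

lemma welfare_eq_geometric_average: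
  fixes lam \<mu> q R\<^sub>0 x :: real and b :: "nat \<Rightarrow> real"
  defines "n \<equiv> nat \<lfloor>x\<rfloor>"
  assumes par: "lam > 0" "\<mu> > 0" "0 < q" "q < 1" and x: "x \<ge> 0"
    and b: "\<And>j. b j \<le> 1 - q" "\<And>j. j \<le> n \<Longrightarrow> b j = 1 - q"
    and step: "\<And>i j. (i, j) \<in> positions (n + 1) \<Longrightarrow>
      (lam + \<mu>) * z i j = first_step lam \<mu> (- 1) (q * R\<^sub>0) (threshold x) b z i j"
  shows "welfare lam x
           (THE p. bd_stationary (\<lambda>j. lam * threshold x (j + 1)) (\<lambda>j. \<mu> * (1 - b j)) p) z
       = geometric_average (lam / (\<mu> * q)) (net_rate (\<mu> * q * R\<^sub>0)) n
           (q * (x - real n) / (1 - b (n + 1)))"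
proof -
  define u where "u = threshold x"
  define W where "W = bd_weight (\<lambda>j. lam * u (j + 1)) (\<lambda>j. \<mu> * (1 - b j))"
  define Z where "Z = (\<Sum>j\<le>n+1. W j)"
  let ?\<rho> = "lam / (\<mu> * q)" and ?t = "q * (x - real n) / (1 - b (n + 1))"
  let ?g = "net_rate (\<mu> * q * R\<^sub>0)"
  note thr = threshold_simps[OF x, folded u_def n_def]
  have d: "1 - b j > 0" for j using b(1)[of j] par by linarith
  have p: "(THE p. bd_stationary (\<lambda>j. lam * u (j + 1)) (\<lambda>j. \<mu> * (1 - b j)) p) = (\<lambda>j. W j / Z)"
    unfolding W_def Z_def
    by (rule the_bd_stationary)
      (use par d threshold_bounds[OF x] thr in \<open>simp_all add: u_def\<close>)
  have bal: "W j * (lam * u (j + 1)) = W (j + 1) * (\<mu> * (1 - b (j + 1)))" for j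
    unfolding W_def by (rule bd_weight_balance) (use par d[of "j + 1"] in simp)
  have W_pow: "W j = ?\<rho> ^ j" if "j \<le> n" for j
  proof -
    have "W j = (\<Prod>k<j. ?\<rho>)"
      unfolding W_def bd_weight_def using that thr(1) b(2) by (intro prod.cong) auto
    then show ?thesis by simp
  qed
  have W_last: "W (n + 1) = ?t * ?\<rho> ^ (n + 1)"
  proof -
    have "W (n + 1) = ?\<rho> ^ n * (lam * (x - real n)) / (\<mu> * (1 - b (n + 1)))"
      using bal[of n] W_pow[of n] thr(2) d[of "n + 1"] par by (simp add: nonzero_eq_divide_eq)
    also have "\<dots> = ?t * (?\<rho> ^ n * ?\<rho>)" using par by (simp add: mult.commute mult.left_commute)
    finally show ?thesis by (simp only: power_add power_one_right)
  qed
  have sum_split: "(\<Sum>j\<le>n+1. W j * f j) = (\<Sum>j\<le>n. ?\<rho> ^ j * f j) + ?t * (?\<rho> ^ (n + 1) * f (n + 1))" for f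
    using W_pow W_last by simp
  have Z: "Z = (\<Sum>j\<le>n. ?\<rho> ^ j) + ?t * ?\<rho> ^ (n + 1)"
    using sum_split[of "\<lambda>_. 1"] by (simp add: Z_def)
  have "welfare lam x (\<lambda>j. W j / Z) z
      = lam * ((\<Sum>k=1..n. W (k - 1) * z k k) + (x - real n) * W n * z (n + 1) (n + 1)) / Z"
    by (simp add: welfare_def Let_def n_def[symmetric] add_divide_distrib distrib_left sum_divide_distrib[symmetric])
  also have "lam * ((\<Sum>k=1..n. W (k - 1) * z k k) + (x - real n) * W n * z (n + 1) (n + 1))
      = (\<Sum>j\<le>n+1. W j * (lam * u (j + 1) * z (j + 1) (j + 1)))"
  proof -
    have "(\<Sum>k=1..n. W (k - 1) * z k k) = (\<Sum>j<n. W j * z (Suc j) (Suc j))"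
      by (rule sum.reindex_bij_witness[of _ Suc "\<lambda>k. k - 1"]) auto
    moreover have "(\<Sum>j\<le>n+1. W j * (lam * u (j + 1) * z (j + 1) (j + 1)))
       = (\<Sum>j<n. lam * (W j * z (Suc j) (Suc j))) + lam * (x - real n) * W n * z (n + 1) (n + 1)"
      by (simp add: lessThan_Suc_atMost[symmetric] thr mult.assoc mult.left_commute)
    ultimately show ?thesis by (simp add: sum_distrib_left algebra_simps)
  qed
  also have "\<dots> = (\<Sum>j\<le>n+1. W j * ?g j)"
  proof -
    have "- 1 * real j + \<mu> * (q * R\<^sub>0) = \<mu> * q * R\<^sub>0 - real j" for j by simp
    moreover have "u (n + 1 + 1) = 0" by (simp add: thr)
    ultimately show ?thesis
      using total_payoff_balance[OF step[folded u_def] bal] by (simp only: net_rate_def)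
  qed
  finally show ?thesis
    unfolding u_def[symmetric] p sum_split Z geometric_average_def by simp
qed

section \<open>Both welfare functions interpolate one sequence\<close>

text \<open>
  The payoffs \<open>R\<^sub>0 - w\<close> inherit a first-step system from the remaining times \<open>w\<close>: a success, of
  probability \<open>q\<close>, ends the remaining time at \<open>0\<close>, and so yields the lump sum \<open>q * R\<^sub>0\<close>.
\<close>

lemma S_N_eq:
  fixes lam \<mu> q R\<^sub>0 x :: real
  assumes par: "lam > 0" "\<mu> > 0" "0 < q" "q < 1" and x: "x \<ge> 0"
  shows "S_N lam \<mu> q R\<^sub>0 x = geometric_average (lam / (\<mu> * q)) (net_rate (\<mu> * q * R\<^sub>0))
           (nat \<lfloor>x\<rfloor>) (x - real (nat \<lfloor>x\<rfloor>))"
proof -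
  let ?w = "remaining_time lam \<mu> q x" and ?m = "nat \<lceil>x\<rceil> + 1"
  have sys: "remaining_time_system lam \<mu> q x w \<longleftrightarrow>
      (\<forall>(i, j) \<in> positions ?m.
         (lam + \<mu>) * w i j = first_step lam \<mu> 1 0 (threshold x) (\<lambda>_. 1 - q) w i j) \<and>
      (\<forall>i j. (i, j) \<notin> positions ?m \<longrightarrow> w i j = 0)" for w
    by (simp add: remaining_time_system_def first_step_def Let_def)
  have "\<exists>!w. remaining_time_system lam \<mu> q x w"
    unfolding sys
    by (rule first_step_unique_solution[OF par threshold_bounds[OF x]]) (use par in auto)
  then have "remaining_time_system lam \<mu> q x ?w"
    unfolding remaining_time_def by (rule theI')
  then have w: "(lam + \<mu>) * ?w i j = first_step lam \<mu> 1 0 (threshold x) (\<lambda>_. 1 - q) ?w i j"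
    if "(i, j) \<in> positions ?m" for i j
    using that unfolding sys by auto
  have z: "(lam + \<mu>) * payoff_N lam \<mu> q R\<^sub>0 x i j =
      first_step lam \<mu> (- 1) (q * R\<^sub>0) (threshold x) (\<lambda>_. 1 - q) (payoff_N lam \<mu> q R\<^sub>0 x) i j"
    if "(i, j) \<in> positions (nat \<lfloor>x\<rfloor> + 1)" for i j
  proof -
    \<comment> \<open>The triangle for remaining times is bounded by a ceiling, the one for payoffs by a floor.\<close>
    have "nat \<lfloor>x\<rfloor> \<le> nat \<lceil>x\<rceil>" by (intro nat_mono) linarith
    then have "(i, j) \<in> positions ?m" using that by (auto simp: positions_def)
    from w[OF this] show ?thesis
      by (cases "i = 1") (simp_all add: payoff_N_def first_step_def algebra_simps)
  qed
  show ?thesis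
    using welfare_eq_geometric_average[OF par x _ _ z] par
    by (simp add: S_N_def stationary_N_def)
qed

lemma S_R_eq:
  fixes lam \<mu> q R\<^sub>0 x :: real
  defines "n \<equiv> nat \<lfloor>x\<rfloor>"
  assumes par: "lam > 0" "\<mu> > 0" "0 < q" "q < 1" and x: "x \<ge> 0"
  shows "S_R lam \<mu> q R\<^sub>0 x = geometric_average (lam / (\<mu> * q)) (net_rate (\<mu> * q * R\<^sub>0))
           n (q * (x - real n) / (1 - (1 - q) * (x - real n)))"
proof -
  let ?z = "payoff_R lam \<mu> q R\<^sub>0 x" and ?b = "\<lambda>j. (1 - q) * threshold x j"
  have prob: "1 - (1 - q) * v = q + (1 - q) * (1 - v)" for v :: real
    by (simp add: algebra_simps)
  have sys: "reneging_payoff_system lam \<mu> q R\<^sub>0 x z \<longleftrightarrow>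
      (\<forall>(i, j) \<in> positions (n + 1).
         (lam + \<mu>) * z i j = first_step lam \<mu> (- 1) (q * R\<^sub>0) (threshold x) ?b z i j) \<and>
      (\<forall>i j. (i, j) \<notin> positions (n + 1) \<longrightarrow> z i j = 0)" for z
    by (simp add: reneging_payoff_system_def first_step_def Let_def n_def prob)
  have b: "0 \<le> ?b j" "?b j \<le> 1 - q" for j
    using threshold_bounds[OF x, of j] par by (simp_all add: mult_left_le)
  have "\<exists>!z. reneging_payoff_system lam \<mu> q R\<^sub>0 x z"
    unfolding sys
    by (rule first_step_unique_solution[OF par threshold_bounds[OF x] b]) simp
  then have "reneging_payoff_system lam \<mu> q R\<^sub>0 x ?z"
    unfolding payoff_R_def by (rule theI')
  then have z: "(lam + \<mu>) * ?z i j =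
      first_step lam \<mu> (- 1) (q * R\<^sub>0) (threshold x) ?b ?z i j"
    if "(i, j) \<in> positions (nat \<lfloor>x\<rfloor> + 1)" for i j
    using that unfolding sys n_def by auto
  have death: "\<mu> * q + \<mu> * (1 - q) * (1 - v) = \<mu> * (1 - (1 - q) * v)" for v :: real
    by (simp add: algebra_simps)
  show ?thesis
    using welfare_eq_geometric_average[OF par x b(2) _ z] threshold_simps[OF x] par
    by (simp add: S_R_def stationary_R_def n_def death)
qed

text \<open>
  Numerator and denominator are both affine in \<open>t\<close>, so the quotient lies between its values at
  \<open>t = 0\<close> and \<open>t = 1\<close>, and the value at \<open>t = 1\<close> is the undamped mean for \<open>n + 1\<close>.
\<close>

lemma geometric_average_le:
  assumes \<rho>: "\<rho> > 0" and t: "0 \<le> t" "t \<le> 1"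
    and B: "\<And>k. geometric_average \<rho> g k 0 \<le> B"
  shows "geometric_average \<rho> g n t \<le> B"
proof -
  define N where "N k = (\<Sum>j\<le>k. \<rho> ^ j * g j)" for k
  define D where "D k = (\<Sum>j\<le>k. \<rho> ^ j)" for k
  have D: "D k > 0" for k unfolding D_def by (rule sum_pos) (use \<rho> in auto)
  have le: "N k \<le> B * D k" for k
    using B[of k] D[of k] by (simp add: geometric_average_def N_def[symmetric] D_def[symmetric] pos_divide_le_eq)
  have "N n + t * (\<rho> ^ (n + 1) * g (n + 1)) = (1 - t) * N n + t * N (Suc n)"
    by (simp add: N_def algebra_simps)
  also have "\<dots> \<le> (1 - t) * (B * D n) + t * (B * D (Suc n))"
    using le t by (intro add_mono mult_left_mono) auto
  also have "\<dots> = B * (D n + t * \<rho> ^ (n + 1))"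
    by (simp add: D_def algebra_simps)
  finally have "N n + t * (\<rho> ^ (n + 1) * g (n + 1)) \<le> B * (D n + t * \<rho> ^ (n + 1))" .
  moreover have "D n + t * \<rho> ^ (n + 1) > 0" using D[of n] t \<rho> by (simp add: add_pos_nonneg)
  ultimately show ?thesis
    by (simp add: geometric_average_def N_def[symmetric] D_def[symmetric] pos_divide_le_eq)
qed

text \<open>
  The maximum \<open>M\<close> over \<open>{0..K}\<close> is nonnegative because the mean for \<open>n = 0\<close> is \<open>g 0 = 0\<close>. From \<open>K\<close> on,
  each new state contributes a value \<open>g j \<le> 0 \<le> M\<close>, so the mean cannot rise above \<open>M\<close>.
\<close>

lemma geometric_average_attains_max:
  assumes \<rho>: "\<rho> > 0" and g0: "g 0 = 0" and tail: "\<And>j. j \<ge> K \<Longrightarrow> g j \<le> 0"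
  shows "\<exists>n. \<forall>k. geometric_average \<rho> g k 0 \<le> geometric_average \<rho> g n 0"
proof -
  define F where "F k = geometric_average \<rho> g k 0" for k
  define M where "M = Max (F ` {..K})"
  have M: "F k \<le> M" if "k \<le> K" for k using that by (simp add: M_def)
  have M0: "0 \<le> M" using M[of 0] g0 by (simp add: F_def geometric_average_def)
  have D: "(\<Sum>j\<le>k. \<rho> ^ j) > 0" for k by (rule sum_pos) (use \<rho> in auto)
  have F_le: "F k \<le> M \<longleftrightarrow> (\<Sum>j\<le>k. \<rho> ^ j * g j) \<le> M * (\<Sum>j\<le>k. \<rho> ^ j)" for k
    using D[of k] by (simp add: F_def geometric_average_def pos_divide_le_eq)
  have "F k \<le> M" for k
  proof (cases "k \<le> K")
    case True
    then show ?thesis by (rule M)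
  next
    case False
    then have "K \<le> k" by simp
    then show ?thesis
    proof (induction k rule: dec_induct)
      case base
      then show ?case by (rule M) simp
    next
      case (step k)
      have "g (Suc k) \<le> 0" by (rule tail) (use step in simp)
      then have "\<rho> ^ Suc k * g (Suc k) \<le> 0"
        using \<rho> by (intro mult_nonneg_nonpos) auto
      also have "0 \<le> M * \<rho> ^ Suc k" using M0 \<rho> by simp
      finally show ?case using step.IH unfolding F_le by (simp add: distrib_left)
    qed
  qed
  moreover have "M \<in> F ` {..K}" unfolding M_def by (rule Max_in) auto
  ultimately show ?thesis unfolding F_def by auto
qed

theorem mainTheorem6:
  fixes lam \<mu> q R\<^sub>0 :: real
  assumes "lam > 0" and "\<mu> > 0" and "0 < q" and "q < 1"
    and "R\<^sub>0 > 0" and "R\<^sub>0 > 1 / (\<mu> * q)"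
  shows "\<exists>n::nat.
           socially_optimal (S_N lam \<mu> q R\<^sub>0) (real n) \<and>
           socially_optimal (S_R lam \<mu> q R\<^sub>0) (real n) \<and>
           S_N lam \<mu> q R\<^sub>0 (real n) = (SUP x\<in>{0..}. S_N lam \<mu> q R\<^sub>0 x) \<and>
           (SUP x\<in>{0..}. S_N lam \<mu> q R\<^sub>0 x) = (SUP x\<in>{0..}. S_R lam \<mu> q R\<^sub>0 x) \<and>
           (SUP x\<in>{0..}. S_R lam \<mu> q R\<^sub>0 x) = S_R lam \<mu> q R\<^sub>0 (real n)"
proof -
  note par = assms(1-4)
  let ?F = "geometric_average (lam / (\<mu> * q)) (net_rate (\<mu> * q * R\<^sub>0))"
  have \<rho>: "lam / (\<mu> * q) > 0" using par by simp
  have "net_rate (\<mu> * q * R\<^sub>0) j \<le> 0" if "j \<ge> nat \<lceil>\<mu> * q * R\<^sub>0\<rceil>" for j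
    using that by (simp add: net_rate_def)
  moreover have "net_rate (\<mu> * q * R\<^sub>0) 0 = 0" by (simp add: net_rate_def)
  ultimately obtain n where n: "\<And>k. ?F k 0 \<le> ?F n 0"
    using geometric_average_attains_max[OF \<rho>] by blast
  have at_n: "S_N lam \<mu> q R\<^sub>0 (real n) = ?F n 0" "S_R lam \<mu> q R\<^sub>0 (real n) = ?F n 0"
    using S_N_eq[OF par, of "real n"] S_R_eq[OF par, of "real n"] by simp_all
  have le_N: "S_N lam \<mu> q R\<^sub>0 x \<le> ?F n 0" if "x \<ge> 0" for x
    unfolding S_N_eq[OF par that]
    by (rule geometric_average_le[OF \<rho> _ _ n]) (use threshold_simps(4,5)[OF that] in auto)
  have le_R: "S_R lam \<mu> q R\<^sub>0 x \<le> ?F n 0" if "x \<ge> 0" for x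
  proof -
    let ?p = "x - real (nat \<lfloor>x\<rfloor>)"
    have p: "0 \<le> ?p" "?p \<le> 1" using threshold_simps(4,5)[OF that] by auto
    have "(1 - q) * ?p \<le> 1 - q" using p par by (simp add: mult_left_le)
    then have "0 < 1 - (1 - q) * ?p" using par by linarith
    then have "q * ?p / (1 - (1 - q) * ?p) \<le> 1" "0 \<le> q * ?p / (1 - (1 - q) * ?p)"
      using p par by (simp_all add: algebra_simps)
    then show ?thesis
      unfolding S_R_eq[OF par that] by (intro geometric_average_le[OF \<rho> _ _ n])
  qed
  have "(SUP x\<in>{0..}. S_N lam \<mu> q R\<^sub>0 x) = ?F n 0"
    by (rule cSup_eq_maximum) (use at_n le_N in \<open>auto intro!: rev_image_eqI[of "real n"]\<close>)
  moreover have "(SUP x\<in>{0..}. S_R lam \<mu> q R\<^sub>0 x) = ?F n 0"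
    by (rule cSup_eq_maximum) (use at_n le_R in \<open>auto intro!: rev_image_eqI[of "real n"]\<close>)
  moreover have "socially_optimal (S_N lam \<mu> q R\<^sub>0) (real n)"
    using le_N at_n by (auto simp: socially_optimal_def is_arg_max_linorder)
  moreover have "socially_optimal (S_R lam \<mu> q R\<^sub>0) (real n)"
    using le_R at_n by (auto simp: socially_optimal_def is_arg_max_linorder)
  ultimately show ?thesis using at_n by auto
qed

end
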